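(* Let $$L = \begin{pmatrix} I_p & 0\\ Y & I_{r-p}\end{pmatrix},\qquad U = \begin{pmatrix} I_p & X\\ 0 & I_{r-p}\end{pmatrix}$$ be complex block matrices (with $X$ of size $p\times(r-p)$ and $Y$ of size $(r-p)\times p$). Set $$A = L+U,\qquad C = -U^{-1}L.$$ Let $\mu\neq 0$ be a complex number, $\sqrt\mu$ any of its square roots, and $$\lambda = 2 - \sqrt{\mu} - 1/\sqrt{\mu}.$$ Then a vector $v_C = \begin{pmatrix} v_1\\ v_2\end{pmatrix}$ is an eigenvector of $C$ with eigenvalue $\mu$ if and only if $$v_A = \begin{pmatrix} v_1\\ \sqrt{\mu}\,v_2\end{pmatrix}$$ is an eigenvector of $A$ with eigenvalue $\lambda$.
   Context: $I_m$ is the $m\times m$ identity matrix; $v_1\in\mathbb{C}^p$, $v_2\in\mathbb{C}^{r-p}$. *)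

theory Defs
  imports
    Complex_Main
    "Jordan_Normal_Form.Gauss_Jordan_Elimination"
    "Jordan_Normal_Form.Char_Poly"
begin

(* mat_inverse is option-valued; this shows that "the (mat_inverse U)" is the
   genuine two-sided inverse for the block unitriangular U under consideration. *)
lemma mat_inverse_upper_unitriangular_block:
  fixes X :: "'a :: field mat"
  assumes X: "X \<in> carrier_mat p q"
  defines "U \<equiv> four_block_mat (1\<^sub>m p) X (0\<^sub>m q p) (1\<^sub>m q)"
  shows "the (mat_inverse U) \<in> carrier_mat (p + q) (p + q)"
    and "U * the (mat_inverse U) = 1\<^sub>m (p + q)"
    and "the (mat_inverse U) * U = 1\<^sub>m (p + q)"
proof -
  define V where "V = four_block_mat (1\<^sub>m p) (- X) (0\<^sub>m q p) (1\<^sub>m q)"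
  have U: "U \<in> carrier_mat (p + q) (p + q)" and V: "V \<in> carrier_mat (p + q) (p + q)"
    using X by (auto simp: U_def V_def)
  have zero: "- 0\<^sub>m q q + 1\<^sub>m q = (1\<^sub>m q :: 'a mat)" by (rule eq_matI) auto
  have cancel: "X + - X = 0\<^sub>m p q" by (rule eq_matI) (use X in auto)
  have UV: "U * V = 1\<^sub>m (p + q)" unfolding U_def V_def
    by (subst mult_four_block_mat[of _ p p _ q _ q _ _ p _ q])
      (use X in \<open>auto simp: uminus_l_inv_mat zero cancel\<close>)
  have VU: "V * U = 1\<^sub>m (p + q)" unfolding U_def V_def
    by (subst mult_four_block_mat[of _ p p _ q _ q _ _ p _ q])
      (use X in \<open>auto simp: uminus_l_inv_mat zero cancel\<close>)
  have "U \<in> Units (ring_mat TYPE('a) (p + q) ())"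
    using U V UV VU unfolding Units_def by (auto simp: ring_mat_def)
  then obtain B where B: "mat_inverse U = Some B"
    using mat_inverse(1)[OF U, where b = "()"] by (cases "mat_inverse U") auto
  with mat_inverse(2)[OF U B]
  show "the (mat_inverse U) \<in> carrier_mat (p + q) (p + q)"
    and "U * the (mat_inverse U) = 1\<^sub>m (p + q)"
    and "the (mat_inverse U) * U = 1\<^sub>m (p + q)" by auto
qed

end

theory Submission
  imports Defs
begin

text \<open>Multiplying by \<open>U\<close>, the eigenvalue equation for \<open>C\<close> becomes \<open>- L v = \<mu> U v\<close>. By blocks, both eigenvalue
  equations then reduce to \<open>\<mu> X v2 = - (\<mu> + 1) v1\<close> and \<open>Y v1 = - (\<mu> + 1) v2\<close>, since
  \<open>s (lam - 2) = - (\<mu> + 1)\<close>.\<close>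

lemma append_vec_eq_zero_iff:
  fixes v w :: "'a :: zero vec"
  assumes "v \<in> carrier_vec n" "w \<in> carrier_vec m"
  shows "v @\<^sub>v w = 0\<^sub>v (n + m) \<longleftrightarrow> v = 0\<^sub>v n \<and> w = 0\<^sub>v m"
proof -
  have "0\<^sub>v (n + m) = 0\<^sub>v n @\<^sub>v (0\<^sub>v m :: 'a vec)"
    by (rule eq_vecI) auto
  then show ?thesis
    using append_vec_eq[OF assms(1) zero_carrier_vec] by simp
qed

lemma smult_append_vec:
  "k \<cdot>\<^sub>v (v @\<^sub>v w) = (k \<cdot>\<^sub>v v) @\<^sub>v (k \<cdot>\<^sub>v w)"
  by (rule eq_vecI) auto

lemma smult_vec_eq_zero_iff:
  fixes v :: "'a :: field vec"
  assumes "v \<in> carrier_vec n" "k \<noteq> 0"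
  shows "k \<cdot>\<^sub>v v = 0\<^sub>v n \<longleftrightarrow> v = 0\<^sub>v n"
  using assms by (auto simp: vec_eq_iff)

text \<open>\<open>U\<close> and \<open>V\<close> are mutually inverse maps on vectors, so applying
  \<open>U\<close> to the left equation gives the right one and applying \<open>V\<close> leads
  back. This removes the inverse inside \<open>C\<close>, leaving only the explicit blocks of
  \<open>L\<close> and \<open>U\<close>.\<close>

lemma neg_inverse_mult_eq_smult_iff:
  fixes U V L :: "'a :: field mat"
  assumes U: "U \<in> carrier_mat n n" and V: "V \<in> carrier_mat n n"
    and L: "L \<in> carrier_mat n n" and v: "v \<in> carrier_vec n"
    and UV: "U * V = 1\<^sub>m n" and VU: "V * U = 1\<^sub>m n"
  shows "(- V * L) *\<^sub>v v = \<mu> \<cdot>\<^sub>v v \<longleftrightarrow> - (L *\<^sub>v v) = \<mu> \<cdot>\<^sub>v (U *\<^sub>v v)"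
proof -
  have Lv: "L *\<^sub>v v \<in> carrier_vec n" using L v by simp
  have C: "(- V * L) *\<^sub>v v = - (V *\<^sub>v (L *\<^sub>v v))"
    using V L v Lv by (simp add: assoc_mult_mat_vec[of _ n n _ n] uminus_mult_mat_vec)
  have neg: "W *\<^sub>v (- w) = - (W *\<^sub>v w)"
    if "W \<in> carrier_mat n n" "w \<in> carrier_vec n" for W :: "'a mat" and w
    using that by (auto intro!: eq_vecI)
  have UVw: "U *\<^sub>v (V *\<^sub>v w) = w" and VUw: "V *\<^sub>v (U *\<^sub>v w) = w" if "w \<in> carrier_vec n" for w
    using assoc_mult_mat_vec[OF U V that] assoc_mult_mat_vec[OF V U that] that UV VU by auto
  show ?thesis unfolding C
  proof
    assume "- (V *\<^sub>v (L *\<^sub>v v)) = \<mu> \<cdot>\<^sub>v v"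
    then have "U *\<^sub>v (- (V *\<^sub>v (L *\<^sub>v v))) = U *\<^sub>v (\<mu> \<cdot>\<^sub>v v)" by simp
    then show "- (L *\<^sub>v v) = \<mu> \<cdot>\<^sub>v (U *\<^sub>v v)"
      using U V Lv v by (simp add: neg UVw mult_mat_vec[of _ n n])
  next
    assume "- (L *\<^sub>v v) = \<mu> \<cdot>\<^sub>v (U *\<^sub>v v)"
    then have "V *\<^sub>v (- (L *\<^sub>v v)) = V *\<^sub>v (\<mu> \<cdot>\<^sub>v (U *\<^sub>v v))" by simp
    then show "- (V *\<^sub>v (L *\<^sub>v v)) = \<mu> \<cdot>\<^sub>v v"
      using U V Lv v by (simp add: neg VUw mult_mat_vec[of _ n n])
  qed
qed

theorem theorem1:
  fixes p r :: nat
    and X Y L U A C :: "complex mat"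
    and v1 v2 :: "complex vec"
    and \<mu> s lam :: complex
  assumes "p \<le> r"
    and "X \<in> carrier_mat p (r - p)"
    and "Y \<in> carrier_mat (r - p) p"
    and "L = four_block_mat (1\<^sub>m p) (0\<^sub>m p (r - p)) Y (1\<^sub>m (r - p))"
    and "U = four_block_mat (1\<^sub>m p) X (0\<^sub>m (r - p) p) (1\<^sub>m (r - p))"
    and "A = L + U"
    and "C = - (the (mat_inverse U)) * L"
    and "\<mu> \<noteq> 0"
    and "s\<^sup>2 = \<mu>"
    and "lam = 2 - s - 1 / s"
    and "v1 \<in> carrier_vec p"
    and "v2 \<in> carrier_vec (r - p)"
  shows "eigenvector C (v1 @\<^sub>v v2) \<mu> \<longleftrightarrow> eigenvector A (v1 @\<^sub>v (s \<cdot>\<^sub>v v2)) lam"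
proof -
  \<comment> \<open>With \<open>q\<close> for \<open>r - p\<close> the total dimension is
    \<open>p + q\<close>, the form in which the block facts are stated.\<close>
  define q where "q = r - p"
  have X: "X \<in> carrier_mat p q" and Y: "Y \<in> carrier_mat q p"
    and v1: "v1 \<in> carrier_vec p" and v2: "v2 \<in> carrier_vec q"
    using assms by (auto simp: q_def)
  have Ldef: "L = four_block_mat (1\<^sub>m p) (0\<^sub>m p q) Y (1\<^sub>m q)"
    and Udef: "U = four_block_mat (1\<^sub>m p) X (0\<^sub>m q p) (1\<^sub>m q)"
    using assms by (simp_all add: q_def)
  have L: "L \<in> carrier_mat (p + q) (p + q)" and U: "U \<in> carrier_mat (p + q) (p + q)"
    using X Y by (auto simp: Ldef Udef)
  note inv = mat_inverse_upper_unitriangular_block[OF X, folded Udef]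
  have s: "s \<noteq> 0" using assms by auto
  define a where "a = X *\<^sub>v v2"
  define b where "b = Y *\<^sub>v v1"
  have a: "a \<in> carrier_vec p" and b: "b \<in> carrier_vec q"
    using X Y v1 v2 by (auto simp: a_def b_def)
  have Lv: "L *\<^sub>v (x @\<^sub>v y) = x @\<^sub>v (Y *\<^sub>v x + y)"
    if "x \<in> carrier_vec p" "y \<in> carrier_vec q" for x y
    unfolding Ldef using that Y
    by (subst four_block_mat_mult_vec[of _ p p _ q _ q]) auto
  have Uv: "U *\<^sub>v (x @\<^sub>v y) = (x + X *\<^sub>v y) @\<^sub>v y"
    if "x \<in> carrier_vec p" "y \<in> carrier_vec q" for x y
    unfolding Udef using that X
    by (subst four_block_mat_mult_vec[of _ p p _ q _ q]) auto
  let ?vC = "v1 @\<^sub>v v2" and ?vA = "v1 @\<^sub>v (s \<cdot>\<^sub>v v2)"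
  have vC: "?vC \<in> carrier_vec (p + q)" and vA: "?vA \<in> carrier_vec (p + q)"
    using v1 v2 by auto
  \<comment> \<open>Two scalar equations are equivalent once their differences of sides agree up to
    a nonzero factor \<open>c\<close>. Each use below then reduces to one algebraic
    identity.\<close>
  have scaled_diff: "x = y \<longleftrightarrow> z = w" if "x - y = c * (z - w)" "c \<noteq> 0" for x y z w c :: complex
    using that by (metis eq_iff_diff_eq_0 mult_eq_0_iff)
  have "C *\<^sub>v ?vC = \<mu> \<cdot>\<^sub>v ?vC \<longleftrightarrow> - (L *\<^sub>v ?vC) = \<mu> \<cdot>\<^sub>v (U *\<^sub>v ?vC)"
    unfolding assms(7) by (rule neg_inverse_mult_eq_smult_iff[OF U inv(1) L vC inv(2,3)])
  also have "\<dots> \<longleftrightarrow> (- v1) @\<^sub>v (- (b + v2)) = (\<mu> \<cdot>\<^sub>v (v1 + a)) @\<^sub>v (\<mu> \<cdot>\<^sub>v v2)"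
  proof -
    have "- (v1 @\<^sub>v (b + v2)) = (- v1) @\<^sub>v (- (b + v2))"
      by (rule eq_vecI) auto
    then show ?thesis
      using v1 v2 by (simp add: Lv Uv smult_append_vec a_def b_def)
  qed
  also have "\<dots> \<longleftrightarrow> - v1 = \<mu> \<cdot>\<^sub>v (v1 + a) \<and> - (b + v2) = \<mu> \<cdot>\<^sub>v v2"
    using v1 a by (intro append_vec_eq[of _ p]) auto
  \<comment> \<open>The meeting point of both eigenvalue equations: coordinatewise, with
    \<open>\<mu>\<close> written as \<open>s * s\<close> so that \<open>s\<close> is the only
    parameter.\<close>
  also have "\<dots> \<longleftrightarrow> (\<forall>i<p. s * s * a $ i = - (s * s + 1) * v1 $ i)
      \<and> (\<forall>i<q. b $ i = - (s * s + 1) * v2 $ i)"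
  proof -
    have "- x = \<mu> * (x + y) \<longleftrightarrow> s * s * y = - (s * s + 1) * x"
      and "- (y + x) = \<mu> * x \<longleftrightarrow> y = - (s * s + 1) * x" for x y
      unfolding assms(9)[symmetric] power2_eq_square
      by (rule scaled_diff[where c = "-1"]; simp add: algebra_simps)+
    \<comment> \<open>Distributing the minus sign would destroy the shape of the two equivalences
      just proved.\<close>
    then show ?thesis using v1 v2 a b by (simp add: vec_eq_iff del: minus_add_distrib)
  qed
  also have "\<dots> \<longleftrightarrow> v1 + (v1 + s \<cdot>\<^sub>v a) = lam \<cdot>\<^sub>v v1
      \<and> b + s \<cdot>\<^sub>v v2 + s \<cdot>\<^sub>v v2 = lam \<cdot>\<^sub>v (s \<cdot>\<^sub>v v2)"
  proof -
    \<comment> \<open>Since \<open>lam - 2 = - (s + 1 / s)\<close>, the difference of sides is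
      \<open>s * y + (s + 1 / s) * x\<close>, which is \<open>1 / s\<close> times that of the
      target. In \<open>e2\<close> the extra \<open>s\<close> beside \<open>x\<close> clears the
      denominator, so the factor is 1.\<close>
    have e1: "x + (x + s * y) = lam * x \<longleftrightarrow> s * s * y = - (s * s + 1) * x" for x y
      unfolding assms(10) using s
      by (intro scaled_diff[where c = "1 / s"]) (simp_all add: field_simps)
    have e2: "y + s * x + s * x = lam * (s * x) \<longleftrightarrow> y = - (s * s + 1) * x" for x y
      unfolding assms(10) using s
      by (intro scaled_diff[where c = 1]) (simp_all add: field_simps)
    show ?thesis
      \<comment> \<open>The order matters: the right side of \<open>e2\<close>, with
        \<open>y\<close> arbitrary, also matches the equations meant for \<open>e1\<close>.\<close>
      unfolding e1[symmetric] unfolding e2[symmetric]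
      using v1 v2 a b by (simp add: vec_eq_iff add.commute)
  qed
  also have "\<dots> \<longleftrightarrow> (v1 + (v1 + s \<cdot>\<^sub>v a)) @\<^sub>v (b + s \<cdot>\<^sub>v v2 + s \<cdot>\<^sub>v v2)
      = (lam \<cdot>\<^sub>v v1) @\<^sub>v (lam \<cdot>\<^sub>v (s \<cdot>\<^sub>v v2))"
    using v1 a by (intro append_vec_eq[symmetric, of _ p]) auto
  also have "\<dots> \<longleftrightarrow> A *\<^sub>v ?vA = lam \<cdot>\<^sub>v ?vA"
  proof -
    have "A *\<^sub>v ?vA = L *\<^sub>v ?vA + U *\<^sub>v ?vA"
      unfolding assms(6) by (rule add_mult_distrib_mat_vec[OF L U vA])
    \<comment> \<open>The factor \<open>s\<close> on the lower block passes through \<open>X\<close>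
      and scales \<open>a\<close>, while \<open>b\<close> comes from \<open>v1\<close> and stays
      unscaled.\<close>
    also have "\<dots> = (v1 @\<^sub>v (b + s \<cdot>\<^sub>v v2)) + ((v1 + s \<cdot>\<^sub>v a) @\<^sub>v (s \<cdot>\<^sub>v v2))"
      using v1 v2 X by (simp add: Lv Uv a_def b_def mult_mat_vec[of _ p q])
    also have "\<dots> = (v1 + (v1 + s \<cdot>\<^sub>v a)) @\<^sub>v (b + s \<cdot>\<^sub>v v2 + s \<cdot>\<^sub>v v2)"
      using v1 v2 a b by (intro append_vec_add[of _ p _ _ q]) auto
    finally show ?thesis by (simp add: smult_append_vec)
  qed
  finally have eq: "C *\<^sub>v ?vC = \<mu> \<cdot>\<^sub>v ?vC \<longleftrightarrow> A *\<^sub>v ?vA = lam \<cdot>\<^sub>v ?vA" .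
  \<comment> \<open>Eigenvectors must also be nonzero; as \<open>s\<close> is nonzero, rescaling the
    lower block preserves this in both directions.\<close>
  have "?vC = 0\<^sub>v (p + q) \<longleftrightarrow> ?vA = 0\<^sub>v (p + q)"
    using v1 v2 s by (simp add: append_vec_eq_zero_iff smult_vec_eq_zero_iff)
  moreover have "dim_row C = p + q" "dim_row A = p + q"
    using inv(1) L U by (auto simp: assms(6,7))
  ultimately show ?thesis
    using eq vC vA by (simp add: eigenvector_def)
qed

end
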